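(* For every $z=x+iy\in\mathbb{C}$ ($x,y\in\mathbb{R}$) with $\Re(z)=x>1$, $$\zeta(z)\zeta(\bar z)=|\zeta(z)|^{2}=\zeta(2x)\sum_{m=1}^{+\infty}\frac{1}{m^{x}}\,2^{\omega(m)}\prod_{p\mid m,\ p\text{ prime}}\cos\!\big(y\ln(p^{v_{p}(m)})\big).$$
   Context: $\zeta(s)=\sum_{n\ge 1}n^{-s}$ for $\Re(s)>1$. $\omega(m)$ is the number of distinct primes dividing $m$, and $v_p(m)$ is the exponent of the prime $p$ in $m$. An empty product equals $1$. *)

theory Defs
  imports "HOL-Analysis.Analysis" "HOL-Computational_Algebra.Computational_Algebra"
begin

(* The Dirichlet series itself, with the index shifted so that Suc n runs over n >= 1.
   It is meant for Re s > 1 only, with no analytic continuation: elsewhere the value of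
   suminf need not have any meaning. *)
definition zeta :: "complex \<Rightarrow> complex" where
  "zeta s = (\<Sum>n. of_nat (Suc n) powr (- s))"

lemma summable_zeta:
  assumes "Re s > 1"
  shows "summable (\<lambda>n. of_nat (Suc n) powr (- s) :: complex)"
proof -
  have *: "norm (of_nat (Suc n) powr (- s) :: complex) = real (Suc n) powr (- Re s)" for n
    by (subst norm_powr_real_powr) (auto simp del: of_nat_Suc)
  have "summable (\<lambda>n. real n powr (- Re s))"
    by (subst summable_real_powr_iff) (use assms in linarith)
  then have "summable (\<lambda>n. real (Suc n) powr (- Re s))"
    by (subst summable_Suc_iff)
  then have "summable (\<lambda>n. norm (of_nat (Suc n) powr (- s) :: complex))"
    by (simp only: *)
  then show ?thesis
    by (rule summable_norm_cancel)
qed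

definition omega :: "nat \<Rightarrow> nat" where
  "omega m = card (prime_factors m)"

(* The m-th term of the series; only used for m >= 1, where prime_factors m is exactly
   the set of primes dividing m and multiplicity p m is v_p(m). *)
definition zeta_term :: "real \<Rightarrow> real \<Rightarrow> nat \<Rightarrow> real" where
  "zeta_term x y m =
     1 / real m powr x * 2 ^ omega m *
       (\<Prod>p\<in>prime_factors m. cos (y * ln (real (p ^ multiplicity p m))))"

end

theory Submission
  imports Defs
begin

text \<open>
  The identity holds because \<open>n \<mapsto> n powr (- z)\<close> and its conjugate are completely multiplicative.
  Multiplying out \<open>|\<zeta>(z)|\<^sup>2\<close> gives an absolutely convergent double series over pairs of positive
  integers.  Every such pair is uniquely \<open>(d * a, d * b)\<close> with \<open>a\<close> and \<open>b\<close> coprime (and \<open>d\<close> the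
  gcd), and complete multiplicativity splits off the factor
  \<open>d powr (- z) * d powr (- cnj z) = d powr (- 2 * x)\<close>.  So the double series is \<open>\<zeta>(2 * x)\<close> times
  the sum over the coprime pairs (lemma \<open>infsum_mult_completely_multiplicative\<close>).

  The coprime pairs are then grouped by their product \<open>m\<close>.  To write \<open>m\<close> as such a product is
  to choose, for each prime dividing \<open>m\<close>, which factor receives its full power in \<open>m\<close>; hence the
  sum over this group is a product over the primes dividing \<open>m\<close> of two-term sums (lemma
  \<open>sum_coprime_factorizations\<close>).  With \<open>q\<close> the full power of such a prime, the two terms are
  conjugate and add up to \<open>2 * q powr (- x) * cos (y * ln q)\<close>, which produces
  \<open>zeta_term x y m\<close>.
\<close>

section \<open>Coprime factorizations\<close>

definition coprime_factorizations :: "nat \<Rightarrow> (nat \<times> nat) set" where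
  "coprime_factorizations m = {(a, b). a * b = m \<and> coprime a b}"

lemma multiplicative_prod_prime_powers:
  fixes f :: "nat \<Rightarrow> 'a::comm_semiring_1"
  assumes one: "f 1 = 1"
    and mult: "\<And>a b. coprime a b \<Longrightarrow> f (a * b) = f a * f b"
    and "finite S" "\<And>p. p \<in> S \<Longrightarrow> prime p"
  shows "f (\<Prod>p\<in>S. p ^ e p) = (\<Prod>p\<in>S. f (p ^ e p))"
  using assms(3,4)
proof (induction S rule: finite_induct)
  case (insert q S)
  have "coprime (q ^ e q) (\<Prod>p\<in>S. p ^ e p)"
    by (intro prod_coprime_right coprime_power_left_iff[THEN iffD2] coprime_power_right_iff[THEN iffD2]
          disjI1 primes_coprime)
       (use insert in auto)
  with insert show ?case
    by (simp add: mult)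
qed (use one in auto)

lemma prime_factors_prod_prime_powers:
  fixes e :: "nat \<Rightarrow> nat"
  assumes "finite S" "\<And>p. p \<in> S \<Longrightarrow> prime p" "\<And>p. p \<in> S \<Longrightarrow> e p > 0"
  shows "prime_factors (\<Prod>p\<in>S. p ^ e p) = S"
  using assms multiplicity_prod_prime_powers[OF assms(1,2), of _ e]
  by (auto simp: prime_factors_multiplicity split: if_splits)

lemma coprime_factor_eq_prod_prime_powers:
  fixes a b :: nat
  assumes "a > 0" "b > 0" "coprime a b"
  shows "a = (\<Prod>p\<in>prime_factors a. p ^ multiplicity p (a * b))"
proof -
  have "multiplicity p (a * b) = multiplicity p a" if "p \<in> prime_factors a" for p
  proof -
    have "prime p" "p dvd a" using that by (auto simp: prime_factors_dvd)
    with assms have "\<not> p dvd b"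
      by (metis coprime_common_divisor not_prime_unit)
    with \<open>prime p\<close> assms show ?thesis
      by (simp add: prime_elem_multiplicity_mult_distrib not_dvd_imp_multiplicity_0)
  qed
  then show ?thesis
    using prod_prime_factors[of a] assms by simp
qed

text \<open>
  A coprime factorization is determined by the set of primes dividing its first factor, and every
  set of prime factors of \<open>m\<close> occurs.  So the left-hand side is the expansion of the product on the
  right over the subsets of \<open>prime_factors m\<close>.
\<close>

lemma sum_coprime_factorizations:
  fixes f g :: "nat \<Rightarrow> 'a::comm_semiring_1"
  assumes f: "f 1 = 1" "\<And>a b. coprime a b \<Longrightarrow> f (a * b) = f a * f b"
    and g: "g 1 = 1" "\<And>a b. coprime a b \<Longrightarrow> g (a * b) = g a * g b"
    and m: "m > 0"
  shows "(\<Sum>(a, b)\<in>coprime_factorizations m. f a * g b) =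
           (\<Prod>p\<in>prime_factors m. f (p ^ multiplicity p m) + g (p ^ multiplicity p m))"
proof -
  let ?P = "prime_factors m"
  define part where "part S = (\<Prod>p\<in>S. p ^ multiplicity p m)" for S
  have fin: "finite S" if "S \<subseteq> ?P" for S
    using that finite_subset by blast
  have part_mult: "part S * part (?P - S) = m" if "S \<subseteq> ?P" for S
    using prod.subset_diff[OF that, of "\<lambda>p. p ^ multiplicity p m"] prod_prime_factors[of m] m
    by (simp add: part_def mult.commute)
  have part_coprime: "coprime (part S) (part T)" if "S \<subseteq> ?P" "T \<subseteq> ?P" "S \<inter> T = {}" for S T
    unfolding part_def
    by (intro prod_coprime_right prod_coprime_left coprime_power_left_iff[THEN iffD2]
          coprime_power_right_iff[THEN iffD2] disjI1 primes_coprime) (use that in auto)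
  have pf_part: "prime_factors (part S) = S" if "S \<subseteq> ?P" for S
    unfolding part_def
    by (rule prime_factors_prod_prime_powers)
       (use that fin in \<open>auto simp: prime_factors_multiplicity\<close>)
  have pos: "a > 0 \<and> b > 0" if "(a, b) \<in> coprime_factorizations m" for a b
    using that m by (auto simp: coprime_factorizations_def intro!: Nat.gr0I)
  have part_fst: "part (prime_factors a) = a" if "(a, b) \<in> coprime_factorizations m" for a b
    using coprime_factor_eq_prod_prime_powers[of a b] that pos[OF that]
    by (auto simp: part_def coprime_factorizations_def)
  have prime_factors_fst: "prime_factors a \<subseteq> ?P" if "(a, b) \<in> coprime_factorizations m" for a b
    using that m by (intro dvd_prime_factors) (auto simp: coprime_factorizations_def)
  have part_snd: "part (?P - prime_factors a) = b" if "(a, b) \<in> coprime_factorizations m" for a b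
  proof -
    have "a * part (?P - prime_factors a) = a * b"
      using part_mult[OF prime_factors_fst[OF that]] part_fst[OF that] that
      by (simp add: coprime_factorizations_def)
    then show ?thesis
      using pos[OF that] by simp
  qed
  have "(\<Sum>(a, b)\<in>coprime_factorizations m. f a * g b) =
          (\<Sum>S\<in>Pow ?P. f (part S) * g (part (?P - S)))"
  proof (rule sum.reindex_bij_witness[of _ "\<lambda>S. (part S, part (?P - S))"
                                           "\<lambda>(a, b). prime_factors a"], goal_cases)
    case (2 ab)
    then show ?case
      using m prime_factors_fst by auto
  next
    case (4 S)
    then show ?case
      by (auto simp: coprime_factorizations_def part_mult intro!: part_coprime)
  qed (auto simp: part_fst part_snd pf_part)
  also have "\<dots> = (\<Sum>S\<in>Pow ?P. (\<Prod>p\<in>S. f (p ^ multiplicity p m)) *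
                                (\<Prod>p\<in>?P - S. g (p ^ multiplicity p m)))"
    unfolding part_def
    by (intro sum.cong refl arg_cong2[of _ _ _ _ "(*)"] multiplicative_prod_prime_powers f g)
       (use fin in auto)
  also have "\<dots> = (\<Prod>p\<in>?P. f (p ^ multiplicity p m) + g (p ^ multiplicity p m))"
    by (rule prod_add [symmetric]) simp
  finally show ?thesis .
qed

section \<open>Products of two completely multiplicative series\<close>

lemma has_sum_mult_Times:
  fixes f g :: "nat \<Rightarrow> complex"
  assumes "f summable_on A" "g summable_on B"
  shows "((\<lambda>(a, b). f a * g b) has_sum (infsum f A * infsum g B)) (A \<times> B)"
proof (rule has_sum_SigmaI[where g = "\<lambda>a. f a * infsum g B"])
  show "(\<lambda>(a, b). f a * g b) summable_on A \<times> B"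
  proof (rule abs_summable_summable)
    have "(\<lambda>a. norm (f a)) summable_on A" "(\<lambda>b. norm (g b)) summable_on B"
      using assms by (simp_all add: summable_on_iff_abs_summable_on_complex)
    then show "(\<lambda>ab. norm (case ab of (a, b) \<Rightarrow> f a * g b)) summable_on A \<times> B"
      unfolding Infinite_Sum.abs_summable_on_Sigma_iff
      by (auto simp: norm_mult infsum_cmult_right' infsum_nonneg
               intro!: summable_on_cmult_right summable_on_cmult_left)
  qed
qed (use assms in \<open>auto intro!: has_sum_cmult_right has_sum_cmult_left has_sum_infsum\<close>)

text \<open>
  This is the analytic core.  The pairs of positive integers are the multiples \<open>(d * a, d * b)\<close> of
  coprime pairs, and the term of the double series at such a pair is \<open>f d * g d\<close> times the term
  at \<open>(a, b)\<close>; the coprime pairs are then collected by their product.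
\<close>

lemma infsum_mult_completely_multiplicative:
  fixes f g :: "nat \<Rightarrow> complex"
  assumes f: "f 1 = 1" "\<And>a b. f (a * b) = f a * f b" "f summable_on {0<..}"
    and g: "g 1 = 1" "\<And>a b. g (a * b) = g a * g b" "g summable_on {0<..}"
  defines "F \<equiv> \<lambda>m. \<Prod>p\<in>prime_factors m. f (p ^ multiplicity p m) + g (p ^ multiplicity p m)"
  shows "F summable_on {0<..}"
    and "infsum f {0<..} * infsum g {0<..} = (\<Sum>\<^sub>\<infinity>d\<in>{0<..}. f d * g d) * infsum F {0<..}"
proof -
  define C where "C = {(a, b). a > 0 \<and> b > 0 \<and> coprime a (b::nat)}"
  define h where "h = (\<lambda>(a, b). f a * g b)"
  have all: "(h has_sum (infsum f {0<..} * infsum g {0<..})) ({0<..} \<times> {0<..})"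
    unfolding h_def by (intro has_sum_mult_Times f g)
  define T where "T = infsum h C"
  have hC: "(h has_sum T) C"
    unfolding T_def
    by (intro has_sum_infsum summable_on_subset_banach[OF has_sum_imp_summable[OF all]])
       (auto simp: C_def)
  have "(h has_sum (infsum f {0<..} * infsum g {0<..})) ({0<..} \<times> {0<..}) \<longleftrightarrow>
        ((\<lambda>(d, ab). f d * g d * h ab) has_sum (infsum f {0<..} * infsum g {0<..})) ({0<..} \<times> C)"
  proof (rule has_sum_reindex_bij_witness[of _ "\<lambda>(d, (a, b)). (d * a, d * b)"
             "\<lambda>(a, b). (gcd a b, (a div gcd a b, b div gcd a b))"], goal_cases)
    case (2 ab)
    then show ?case
      by (auto simp: C_def div_gcd_coprime div_greater_zero_iff intro: gcd_le1_nat gcd_le2_nat)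
  next
    case (3 dab)
    then show ?case
      by (auto simp: C_def gcd_mult_left)
  next
    case (5 ab)
    obtain a b where ab: "ab = (a, b)" by force
    have "f a = f (gcd a b) * f (a div gcd a b)" "g b = g (gcd a b) * g (b div gcd a b)"
      by (simp_all flip: f(2) g(2))
    then show ?case
      by (simp add: ab h_def)
  qed (auto simp: C_def)
  with all have "((\<lambda>(d, ab). f d * g d * h ab) has_sum
                    (infsum f {0<..} * infsum g {0<..})) ({0<..} \<times> C)"
    by simp
  then have by_gcd: "((\<lambda>d. f d * g d * T) has_sum (infsum f {0<..} * infsum g {0<..})) {0<..}"
    by (rule has_sum_SigmaD) (use hC in \<open>auto intro!: has_sum_cmult_right\<close>)
  \<comment> \<open>The series of the \<open>f d * g d\<close> is the diagonal of the double series.\<close>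
  have "h summable_on (\<lambda>d. (d, d)) ` {0<..}"
    by (rule summable_on_subset_banach[OF has_sum_imp_summable[OF all]]) auto
  then have "(\<lambda>d. f d * g d) summable_on {0<..}"
    by (subst (asm) summable_on_reindex) (auto simp: inj_on_def h_def o_def)
  then have "((\<lambda>d. f d * g d * T) has_sum ((\<Sum>\<^sub>\<infinity>d\<in>{0<..}. f d * g d) * T)) {0<..}"
    by (intro has_sum_cmult_left has_sum_infsum)
  with by_gcd have prod_eq:
    "infsum f {0<..} * infsum g {0<..} = (\<Sum>\<^sub>\<infinity>d\<in>{0<..}. f d * g d) * T"
    by (rule has_sum_unique)

  have "(h has_sum T) C \<longleftrightarrow>
        ((\<lambda>(m, ab). h ab) has_sum T) (SIGMA m:{0<..}. coprime_factorizations m)"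
    by (rule has_sum_reindex_bij_witness[of _ snd "\<lambda>(a, b). (a * b, (a, b))"])
       (auto simp: C_def coprime_factorizations_def)
  with hC have "((\<lambda>(m, ab). h ab) has_sum T) (SIGMA m:{0<..}. coprime_factorizations m)"
    by simp
  then have "(F has_sum T) {0<..}"
  proof (rule has_sum_SigmaD, goal_cases)
    case (1 m)
    then have m: "m > 0" by simp
    have "coprime_factorizations m \<subseteq> {..m} \<times> {..m}"
      using m by (auto simp: coprime_factorizations_def)
    then have "finite (coprime_factorizations m)"
      by (rule finite_subset) simp
    moreover have "sum h (coprime_factorizations m) = F m"
      unfolding F_def h_def using f g m by (intro sum_coprime_factorizations) simp_all
    ultimately show ?case
      by (auto intro!: has_sum_finiteI)
  qed
  then show "F summable_on {0<..}"
    and "infsum f {0<..} * infsum g {0<..} = (\<Sum>\<^sub>\<infinity>d\<in>{0<..}. f d * g d) * infsum F {0<..}"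
    using prod_eq by (auto simp: infsumI has_sum_imp_summable)
qed

section \<open>The Dirichlet series of \<open>|\<zeta>|\<^sup>2\<close>\<close>

lemma has_sum_positive_nat_iff:
  "(f has_sum S) {0::nat<..} \<longleftrightarrow> ((\<lambda>n. f (Suc n)) has_sum S) UNIV"
  by (rule has_sum_reindex_bij_witness[of _ Suc "\<lambda>n. n - 1"]) auto

lemma has_sum_zeta:
  assumes "Re s > 1"
  shows "((\<lambda>n. of_nat n powr (- s)) has_sum zeta s) {0<..}"
  unfolding has_sum_positive_nat_iff
proof (rule norm_summable_imp_has_sum)
  show "(\<lambda>n. of_nat (Suc n) powr (- s)) sums zeta s"
    unfolding zeta_def using summable_zeta[OF assms] by (rule summable_sums)
  have "norm (of_nat (Suc n) powr (- s) :: complex) =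
          norm (of_nat (Suc n) powr (- of_real (Re s)) :: complex)" for n
    by (subst (1 2) norm_powr_real_powr) (auto simp del: of_nat_Suc)
  moreover have "summable (\<lambda>n. real n powr (- Re s))"
    using assms by (subst summable_real_powr_iff) linarith
  then have "summable (\<lambda>n. real (Suc n) powr (- Re s))"
    by (subst summable_Suc_iff)
  ultimately show "summable (\<lambda>n. norm (of_nat (Suc n) powr (- s) :: complex))"
    by (subst norm_powr_real_powr) (auto simp del: of_nat_Suc)
qed

lemma of_nat_mult_powr_complex:
  "(of_nat (a * b) :: complex) powr s = of_nat a powr s * of_nat b powr s"
  unfolding of_nat_mult by (rule powr_times_real_left) auto

lemma of_nat_powr_add_cnj:
  fixes z :: complex
  assumes "n > 0"
  shows "of_nat n powr (- z) + of_nat n powr (- cnj z) =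
           of_real (2 * (1 / real n powr Re z) * cos (Im z * ln (real n)))"
proof -
  have "of_nat n powr (- cnj z) = cnj (of_nat n powr (- z))"
    by (subst cnj_powr) auto
  moreover have "Re (of_nat n powr (- z)) =
                   exp (- (Re z * ln (real n))) * cos (Im z * ln (real n))"
    using assms by (simp add: powr_def Re_exp)
  moreover have "exp (- (Re z * ln (real n))) = 1 / real n powr Re z"
    using assms by (simp add: powr_def exp_minus inverse_eq_divide)
  ultimately show ?thesis
    by (simp add: complex_add_cnj)
qed

lemma prod_of_nat_powr_add_cnj:
  fixes z :: complex
  assumes "m > 0"
  shows "(\<Prod>p\<in>prime_factors m. of_nat (p ^ multiplicity p m) powr (- z)
                              + of_nat (p ^ multiplicity p m) powr (- cnj z)) =
         of_real (zeta_term (Re z) (Im z) m)"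
proof -
  let ?P = "prime_factors m" and ?q = "\<lambda>p. p ^ multiplicity p m"
  have "(\<Prod>p\<in>?P. of_nat (?q p) powr (- z) + of_nat (?q p) powr (- cnj z)) =
          (\<Prod>p\<in>?P. of_real (2 * (1 / real (?q p) powr Re z) * cos (Im z * ln (real (?q p)))))"
    by (intro prod.cong refl of_nat_powr_add_cnj) (auto intro!: prime_gt_0_nat)
  also have "\<dots> = of_real (2 ^ omega m * (\<Prod>p\<in>?P. 1 / real (?q p) powr Re z) *
                            (\<Prod>p\<in>?P. cos (Im z * ln (real (?q p)))))"
    by (simp only: of_real_prod[symmetric] prod.distrib prod_constant omega_def)
  also have "(\<Prod>p\<in>?P. 1 / real (?q p) powr Re z) = 1 / real m powr Re z"
  proof -
    have "real m powr Re z = real (\<Prod>p\<in>?P. ?q p) powr Re z"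
      using prod_prime_factors[of m] assms by simp
    also have "\<dots> = (\<Prod>p\<in>?P. real (?q p) powr Re z)"
      by (rule multiplicative_prod_prime_powers) (auto simp: powr_mult)
    finally show ?thesis
      by (simp add: prod_dividef)
  qed
  finally show ?thesis
    by (simp add: zeta_term_def mult_ac)
qed

theorem proposition4p3:
  fixes z :: complex and x y :: real
  assumes "z = complex_of_real x + \<i> * complex_of_real y"
    and "x > 1"
  shows "zeta z * zeta (cnj z) = complex_of_real ((cmod (zeta z))\<^sup>2)
    \<and> summable (\<lambda>m. zeta_term x y (Suc m))
    \<and> complex_of_real ((cmod (zeta z))\<^sup>2)
        = zeta (complex_of_real (2 * x)) * complex_of_real (\<Sum>m. zeta_term x y (Suc m))"
proof -
  have [simp]: "Re z = x" "Im z = y"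
    using assms(1) by simp_all
  let ?f = "\<lambda>n::nat. of_nat n powr (- z) :: complex"
  let ?g = "\<lambda>n::nat. of_nat n powr (- cnj z) :: complex"
  let ?F = "\<lambda>m. \<Prod>p\<in>prime_factors m. ?f (p ^ multiplicity p m) + ?g (p ^ multiplicity p m)"
  have f: "(?f has_sum zeta z) {0<..}" and g: "(?g has_sum zeta (cnj z)) {0<..}"
    using assms(2) by (auto intro!: has_sum_zeta)
  have cnj_f: "?g n = cnj (?f n)" for n
    by (subst cnj_powr) auto
  have "((\<lambda>n. cnj (?f n)) has_sum cnj (zeta z)) {0<..}"
    using f by simp
  with g have "zeta (cnj z) = cnj (zeta z)"
    unfolding cnj_f by (rule has_sum_unique)
  then have norm_eq: "zeta z * zeta (cnj z) = complex_of_real ((cmod (zeta z))\<^sup>2)"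
    by (simp only: complex_norm_square)

  have fg: "?f d * ?g d = of_nat d powr (- complex_of_real (2 * x))" for d
  proof -
    have "- complex_of_real (2 * x) = - z + - cnj z"
      by (simp add: complex_eq_iff)
    then show ?thesis
      by (simp only: powr_add)
  qed
  have zeta_2x: "(\<Sum>\<^sub>\<infinity>d\<in>{0<..}. ?f d * ?g d) = zeta (complex_of_real (2 * x))"
    unfolding fg by (intro infsumI has_sum_zeta) (use assms(2) in simp)
  note product = infsum_mult_completely_multiplicative
    [of ?f ?g, OF _ of_nat_mult_powr_complex has_sum_imp_summable[OF f]
               _ of_nat_mult_powr_complex has_sum_imp_summable[OF g]]
  have "(?F has_sum infsum ?F {0<..}) {0<..}"
    by (intro has_sum_infsum product(1)) simp_all
  then have "((\<lambda>m. complex_of_real (zeta_term x y m)) has_sum infsum ?F {0<..}) {0<..}"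
    by (rule has_sum_cong[THEN iffD1, rotated])
       (use prod_of_nat_powr_add_cnj[of _ z] in simp)
  then have sums: "(\<lambda>m. complex_of_real (zeta_term x y (Suc m))) sums infsum ?F {0<..}"
    unfolding has_sum_positive_nat_iff by (rule has_sum_imp_sums)
  have summable: "summable (\<lambda>m. zeta_term x y (Suc m))"
    using summable_Re[OF sums_summable[OF sums]] by simp
  then have "complex_of_real (\<Sum>m. zeta_term x y (Suc m)) = infsum ?F {0<..}"
    by (simp only: suminf_of_real sums_unique[OF sums])
  moreover have "zeta z * zeta (cnj z) = zeta (complex_of_real (2 * x)) * infsum ?F {0<..}"
    using product(2) by (simp only: infsumI[OF f] infsumI[OF g] zeta_2x) simp
  ultimately show ?thesis
    using norm_eq summable by simp
qed

end
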